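(* Let $F$ be a field, $n\ge 1$, $A\in F^{n\times n}$ and $a\in F$. Put $$H=I_n\otimes A-a(A^t\otimes I_n)\in F^{n^2\times n^2},$$ where $\otimes$ denotes the Kronecker product and $A^t$ the transpose of $A$. Then $H$ is a parity-check matrix for the code $C(A,a)$; that is, for every $B\in F^{n\times n}$, $B\in C(A,a)$ if and only if $H[B]=0$.
   Context: $F^{n\times n}$ denotes the $n\times n$ matrices over $F$. For $A\in F^{n\times n}$ and $a\in F$, $C(A,a):=\{B\in F^{n\times n}\mid AB=aBA\}$, an $F$-subspace of $F^{n\times n}$ (the centralizer code obtained from $A$ and twisted by $a$). For $B\in F^{n\times n}$, $[B]$ denotes the column vector of length $n^2$ obtained by reading the matrix $B$ column by column (i.e. stacking the columns of $B$ from first to last). The Kronecker product $X\otimes Y$ is the block matrix whose $(i,j)$ block is $X_{ij}Y$. *)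

theory Defs
  imports "Jordan_Normal_Form.Matrix"
begin

definition twisted_centralizer :: "nat \<Rightarrow> 'a::field mat \<Rightarrow> 'a \<Rightarrow> 'a mat set" where
  "twisted_centralizer n A a = {B \<in> carrier_mat n n. A * B = a \<cdot>\<^sub>m (B * A)}"

(* Column-by-column reading: indices are 0-based, so entry (i, j) of B lands at
   position j * dim_row B + i. *)
definition vectorize :: "'a mat \<Rightarrow> 'a vec" where
  "vectorize B = vec (dim_row B * dim_col B) (\<lambda>k. B $$ (k mod dim_row B, k div dim_row B))"

(* Entry (p, q) of block (i, j) sits at (i * dim_row Y + p, j * dim_col Y + q)
   and equals X $$ (i, j) * Y $$ (p, q). *)
definition kronecker :: "'a::times mat \<Rightarrow> 'a mat \<Rightarrow> 'a mat" where
  "kronecker X Y = mat (dim_row X * dim_row Y) (dim_col X * dim_col Y)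
     (\<lambda>(i, j). X $$ (i div dim_row Y, j div dim_col Y) * Y $$ (i mod dim_row Y, j mod dim_col Y))"

(* For a code of n x n matrices, viewed inside F^(n^2) via vectorize. The rows of H
   are not required to be linearly independent. *)
definition parity_check_matrix :: "nat \<Rightarrow> 'a::field mat \<Rightarrow> 'a mat set \<Rightarrow> bool" where
  "parity_check_matrix n H C \<longleftrightarrow>
     dim_col H = n\<^sup>2 \<and>
     (\<forall>B \<in> carrier_mat n n. B \<in> C \<longleftrightarrow> H *\<^sub>v vectorize B = 0\<^sub>v (dim_row H))"

lemma vectorize_index:
  assumes "i < dim_row B" "j < dim_col B"
  shows "vectorize B $ (j * dim_row B + i) = B $$ (i, j)"
proof -
  have "j * dim_row B + i < Suc j * dim_row B" using assms by simp
  also have "\<dots> \<le> dim_col B * dim_row B" using assms by (intro mult_le_mono1) simp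
  finally show ?thesis using assms by (simp add: vectorize_def mult.commute)
qed

lemma kronecker_index:
  assumes "i < dim_row X" "j < dim_col X" "p < dim_row Y" "q < dim_col Y"
  shows "kronecker X Y $$ (i * dim_row Y + p, j * dim_col Y + q) = X $$ (i, j) * Y $$ (p, q)"
proof -
  have "i * dim_row Y + p < Suc i * dim_row Y" using assms by simp
  also have "\<dots> \<le> dim_row X * dim_row Y" using assms by (intro mult_le_mono1) simp
  finally have r: "i * dim_row Y + p < dim_row X * dim_row Y" .
  have "j * dim_col Y + q < Suc j * dim_col Y" using assms by simp
  also have "\<dots> \<le> dim_col X * dim_col Y" using assms by (intro mult_le_mono1) simp
  finally have c: "j * dim_col Y + q < dim_col X * dim_col Y" .
  show ?thesis using r c assms by (simp add: kronecker_def)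
qed

end

theory Submission
  imports Defs
begin

text \<open>Vectorization turns two-sided multiplication into a Kronecker product:
  \<open>[Y B X\<^sup>t] = (X \<otimes> Y) [B]\<close>. This is \<open>kronecker_mult_vectorize\<close>; it holds because the position of
  an entry in \<open>[B]\<close> splits into a column index and a row index, and the product with \<open>X \<otimes> Y\<close>
  becomes a double sum over the two. Taking \<open>(X, Y)\<close> to be \<open>(I, A)\<close> and \<open>(A\<^sup>t, I)\<close> gives \<open>[A B]\<close>
  and \<open>[B A]\<close>, so \<open>H [B] = [A B] - a [B A]\<close>. As vectorization respects scalars and is injective
  (\<open>vectorize_smult\<close>, \<open>vectorize_eq_iff\<close>), this vanishes exactly when \<open>A B = a B A\<close>.\<close>

lemma sum_lessThan_mult:
  fixes f :: "nat \<Rightarrow> 'a::comm_monoid_add"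
  shows "(\<Sum>l<q * s. f l) = (\<Sum>j<q. \<Sum>i<s. f (j * s + i))"
proof -
  have "sum f {j * s..<j * s + s} = (\<Sum>i<s. f (j * s + i))" for j
    by (subst sum.atLeastLessThan_shift_0) (simp add: lessThan_atLeast0)
  then show ?thesis by (simp flip: sum.nat_group)
qed

lemma kronecker_mult_vectorize:
  fixes X Y B :: "'a::comm_semiring_0 mat"
  assumes X: "X \<in> carrier_mat p q" and Y: "Y \<in> carrier_mat r s" and B: "B \<in> carrier_mat s q"
  shows "kronecker X Y *\<^sub>v vectorize B = vectorize (Y * B * X\<^sup>T)"
proof (rule eq_vecI)
  show "dim_vec (kronecker X Y *\<^sub>v vectorize B) = dim_vec (vectorize (Y * B * X\<^sup>T))"
    using X Y by (simp add: kronecker_def vectorize_def mult.commute)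
next
  fix k assume "k < dim_vec (vectorize (Y * B * X\<^sup>T))"
  then have k: "k < p * r" using X Y by (simp add: vectorize_def mult.commute)
  define i j where "i = k mod r" and "j = k div r"
  have "0 < r" using k by (cases r) auto
  then have i: "i < r" and j: "j < p"
    using k by (simp_all add: i_def j_def less_mult_imp_div_less)
  have "(kronecker X Y *\<^sub>v vectorize B) $ k
      = (\<Sum>l<q * s. X $$ (j, l div s) * Y $$ (i, l mod s) * B $$ (l mod s, l div s))"
    using k X Y B
    by (simp add: scalar_prod_def kronecker_def vectorize_def i_def j_def lessThan_atLeast0
        mult.commute[of s q])
  also have "\<dots> = (\<Sum>m<q. \<Sum>t<s. X $$ (j, m) * Y $$ (i, t) * B $$ (t, m))"
    by (simp add: sum_lessThan_mult)
  also have "\<dots> = (\<Sum>m<q. (\<Sum>t<s. Y $$ (i, t) * B $$ (t, m)) * X $$ (j, m))"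
    by (simp add: sum_distrib_left sum_distrib_right mult_ac)
  also have "\<dots> = (Y * B * X\<^sup>T) $$ (i, j)"
    using i j X Y B by (simp add: scalar_prod_def lessThan_atLeast0 del: assoc_mult_mat)
  also have "\<dots> = vectorize (Y * B * X\<^sup>T) $ k"
    using k X Y by (simp add: vectorize_def i_def j_def mult.commute)
  finally show "(kronecker X Y *\<^sub>v vectorize B) $ k = vectorize (Y * B * X\<^sup>T) $ k" .
qed

lemma vectorize_smult: "vectorize (c \<cdot>\<^sub>m B) = c \<cdot>\<^sub>v vectorize B"
proof (rule eq_vecI)
  fix k assume "k < dim_vec (c \<cdot>\<^sub>v vectorize B)"
  then have k: "k < dim_col B * dim_row B" by (simp add: vectorize_def mult.commute)
  then have "0 < dim_row B" by (cases "dim_row B") auto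
  with k show "vectorize (c \<cdot>\<^sub>m B) $ k = (c \<cdot>\<^sub>v vectorize B) $ k"
    by (simp add: vectorize_def less_mult_imp_div_less mult.commute)
qed (simp add: vectorize_def)

lemma vectorize_eq_iff:
  assumes "B \<in> carrier_mat m n" "C \<in> carrier_mat m n"
  shows "vectorize B = vectorize C \<longleftrightarrow> B = C"
proof
  assume "vectorize B = vectorize C"
  then show "B = C"
    using assms vectorize_index[of _ B] vectorize_index[of _ C] by (intro eq_matI) force+
qed simp

lemma minus_vec_eq_zero_iff:
  fixes u v :: "'a::group_add vec"
  assumes "u \<in> carrier_vec m" "v \<in> carrier_vec m"
  shows "u - v = 0\<^sub>v m \<longleftrightarrow> u = v"
  using assms by (auto simp: vec_eq_iff)

lemma smult_mat_mult_vec: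
  fixes A :: "'a::comm_semiring_0 mat"
  assumes "A \<in> carrier_mat m n" "v \<in> carrier_vec n"
  shows "(c \<cdot>\<^sub>m A) *\<^sub>v v = c \<cdot>\<^sub>v (A *\<^sub>v v)"
  using assms by (intro eq_vecI) (auto simp: scalar_prod_def sum_distrib_left mult.assoc)

theorem proposition1p1:
  fixes n :: nat and A H :: "'a::field mat" and a :: 'a
  assumes "n \<ge> 1"
    and "A \<in> carrier_mat n n"
    and "H = kronecker (1\<^sub>m n) A - a \<cdot>\<^sub>m kronecker (A\<^sup>T) (1\<^sub>m n)"
  shows "H \<in> carrier_mat (n\<^sup>2) (n\<^sup>2) \<and> parity_check_matrix n H (twisted_centralizer n A a)"
proof -
  note A = assms(2) and H_def = assms(3)
  have K: "kronecker (1\<^sub>m n) A \<in> carrier_mat (n\<^sup>2) (n\<^sup>2)"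
    "kronecker (A\<^sup>T) (1\<^sub>m n) \<in> carrier_mat (n\<^sup>2) (n\<^sup>2)"
    using A by (simp_all add: kronecker_def power2_eq_square)
  then have H: "H \<in> carrier_mat (n\<^sup>2) (n\<^sup>2)" unfolding H_def by (intro minus_carrier_mat smult_carrier_mat)
  have "B \<in> twisted_centralizer n A a \<longleftrightarrow> H *\<^sub>v vectorize B = 0\<^sub>v (n\<^sup>2)"
    if B: "B \<in> carrier_mat n n" for B
  proof -
    have vec: "vectorize M \<in> carrier_vec (n\<^sup>2)" if "M \<in> carrier_mat n n" for M :: "'a mat"
      using that by (auto simp: vectorize_def power2_eq_square)
    have AB: "kronecker (1\<^sub>m n) A *\<^sub>v vectorize B = vectorize (A * B)"
      using kronecker_mult_vectorize[OF one_carrier_mat A B] A B by simp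
    have BA: "kronecker (A\<^sup>T) (1\<^sub>m n) *\<^sub>v vectorize B = vectorize (B * A)"
      using kronecker_mult_vectorize[OF _ one_carrier_mat B, of "A\<^sup>T" n] A B by simp
    have "H *\<^sub>v vectorize B
        = kronecker (1\<^sub>m n) A *\<^sub>v vectorize B - a \<cdot>\<^sub>m kronecker (A\<^sup>T) (1\<^sub>m n) *\<^sub>v vectorize B"
      unfolding H_def using K vec[OF B] by (intro minus_mult_distrib_mat_vec) auto
    also have "a \<cdot>\<^sub>m kronecker (A\<^sup>T) (1\<^sub>m n) *\<^sub>v vectorize B = vectorize (a \<cdot>\<^sub>m (B * A))"
      using smult_mat_mult_vec[OF K(2) vec[OF B]] by (simp add: BA vectorize_smult)
    finally have "H *\<^sub>v vectorize B = vectorize (A * B) - vectorize (a \<cdot>\<^sub>m (B * A))"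
      by (simp add: AB)
    then show ?thesis
      using A B
      by (simp add: twisted_centralizer_def minus_vec_eq_zero_iff vec vectorize_eq_iff[of _ n n])
  qed
  with H show ?thesis by (auto simp: parity_check_matrix_def)
qed

end
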